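(* Let $\mathscr{H}_1$ and $\mathscr{H}_2$ be infinite-dimensional complex Hilbert spaces, let $D_1 \in \mathscr{B}(\mathscr{H}_1)$ and $D_2 \in \mathscr{B}(\mathscr{H}_2)$ be fixed operators, and let $\Psi : \mathscr{B}(\mathscr{H}_1) \to \mathscr{B}(\mathscr{H}_2)$ be a linear map such that $$\Psi(A_1) \circ \Psi(A_2) = D_2 \quad \text{whenever} \quad A_1 \circ A_2 = D_1$$ for all $A_1, A_2 \in \mathscr{B}(\mathscr{H}_1)$. Then $\Psi$ preserves square-zero operators, that is, for every $A_1 \in \mathscr{B}(\mathscr{H}_1)$ with $A_1^2 = 0$ one has $\Psi(A_1)^2 = 0$.
   Context: $\mathscr{B}(\mathscr{H})$ denotes the algebra of bounded linear operators on the Hilbert space $\mathscr{H}$. The symbol $\circ$ denotes the Jordan product $A_1 \circ A_2 = A_1A_2 + A_2A_1$ (not composition). *)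

theory Defs
  imports "HOL-Analysis.Analysis"
begin

class complex_vector = ab_group_add +
  fixes scaleC :: "complex \<Rightarrow> 'a \<Rightarrow> 'a"  (infixr "*\<^sub>C" 75)
  assumes scaleC_add_right: "a *\<^sub>C (x + y) = a *\<^sub>C x + a *\<^sub>C y"
    and scaleC_add_left: "(a + b) *\<^sub>C x = a *\<^sub>C x + b *\<^sub>C x"
    and scaleC_scaleC: "a *\<^sub>C b *\<^sub>C x = (a * b) *\<^sub>C x"
    and scaleC_one: "1 *\<^sub>C x = x"

global_interpretation complex_vector:
  vector_space "scaleC :: complex \<Rightarrow> 'a \<Rightarrow> 'a::complex_vector"
  by unfold_locales
    (simp_all add: scaleC_add_right scaleC_add_left scaleC_scaleC scaleC_one)

abbreviation clinear :: "('a::complex_vector \<Rightarrow> 'b::complex_vector) \<Rightarrow> bool" where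
  "clinear \<equiv> Vector_Spaces.linear scaleC scaleC"

definition infinite_cdim :: "'a::complex_vector itself \<Rightarrow> bool" where
  "infinite_cdim _ \<longleftrightarrow> \<not> (\<exists>B::'a set. finite B \<and> complex_vector.span B = UNIV)"

text \<open>Complex Hilbert spaces: Banach spaces whose norm comes from a complex inner product,
  linear in its first argument.\<close>

class chilbert_space = complex_vector + banach +
  fixes cinner :: "'a \<Rightarrow> 'a \<Rightarrow> complex"
  assumes scaleR_scaleC: "r *\<^sub>R x = complex_of_real r *\<^sub>C x"
    and cinner_commute: "cinner x y = cnj (cinner y x)"
    and cinner_add_left: "cinner (x + y) z = cinner x z + cinner y z"
    and cinner_scaleC_left: "cinner (c *\<^sub>C x) y = c * cinner x y"
    and cinner_ge_zero: "0 \<le> Re (cinner x x)"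
    and cinner_eq_zero_iff: "cinner x x = 0 \<longleftrightarrow> x = 0"
    and norm_eq_sqrt_cinner: "norm x = sqrt (Re (cinner x x))"

text \<open>The algebra of bounded operators on \<open>'a\<close>: the library's \<^const>\<open>bounded_linear\<close> is
  real-linear, so complex homogeneity is added.\<close>

typedef (overloaded) 'a bounded_op =
  "{f :: 'a::chilbert_space \<Rightarrow> 'a. bounded_linear f \<and> (\<forall>c x. f (c *\<^sub>C x) = c *\<^sub>C f x)}"
  morphisms apply_op Bounded_op
  by (rule exI[of _ "\<lambda>_. 0"]) (simp add: complex_vector.scale_zero_right)

setup_lifting type_definition_bounded_op

lemma bounded_linear_scaleC: "bounded_linear (\<lambda>x::'a::chilbert_space. c *\<^sub>C x)"
proof (rule bounded_linear_intro)
  show "c *\<^sub>C (x + y) = c *\<^sub>C x + c *\<^sub>C y" for x y :: 'a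
    by (rule scaleC_add_right)
  show "c *\<^sub>C (r *\<^sub>R x) = r *\<^sub>R (c *\<^sub>C x)" for r and x :: 'a
    by (simp add: scaleR_scaleC scaleC_scaleC mult.commute)
  show "norm (c *\<^sub>C x) \<le> norm x * cmod c" for x :: 'a
  proof -
    have "cinner (c *\<^sub>C x) (c *\<^sub>C x) = c * cnj (c * cinner x x)"
      by (metis cinner_scaleC_left cinner_commute)
    also have "\<dots> = complex_of_real ((cmod c)\<^sup>2) * cinner x x"
      by (metis cinner_commute complex_cnj_mult complex_norm_square mult.assoc)
    finally have "Re (cinner (c *\<^sub>C x) (c *\<^sub>C x)) = (cmod c)\<^sup>2 * Re (cinner x x)"
      by simp
    then show ?thesis
      by (simp add: norm_eq_sqrt_cinner real_sqrt_mult mult.commute)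
  qed
qed

instantiation bounded_op :: (chilbert_space) ring
begin
lift_definition zero_bounded_op :: "'a bounded_op" is "\<lambda>_. 0"
  by simp
lift_definition plus_bounded_op :: "'a bounded_op \<Rightarrow> 'a bounded_op \<Rightarrow> 'a bounded_op"
  is "\<lambda>f g x. f x + g x"
  by (simp add: bounded_linear_add scaleC_add_right)
lift_definition minus_bounded_op :: "'a bounded_op \<Rightarrow> 'a bounded_op \<Rightarrow> 'a bounded_op"
  is "\<lambda>f g x. f x - g x"
  by (simp add: bounded_linear_sub complex_vector.scale_right_diff_distrib)
lift_definition uminus_bounded_op :: "'a bounded_op \<Rightarrow> 'a bounded_op"
  is "\<lambda>f x. - f x"
  by (simp add: bounded_linear_minus)
lift_definition times_bounded_op :: "'a bounded_op \<Rightarrow> 'a bounded_op \<Rightarrow> 'a bounded_op"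
  is "\<lambda>f g x. f (g x)"
  by (simp add: bounded_linear_compose)
instance
  by standard (transfer; force simp: linear_simps)+
end

text \<open>Not \<^class>\<open>ring_1\<close>, which requires \<open>0 \<noteq> 1\<close> and so fails on the zero space.\<close>

instantiation bounded_op :: (chilbert_space) monoid_mult
begin
lift_definition one_bounded_op :: "'a bounded_op" is "\<lambda>x. x"
  by simp
instance
  by standard (transfer; simp)+
end

instantiation bounded_op :: (chilbert_space) complex_vector
begin
lift_definition scaleC_bounded_op :: "complex \<Rightarrow> 'a bounded_op \<Rightarrow> 'a bounded_op"
  is "\<lambda>c f x. c *\<^sub>C f x"
  by (auto intro: bounded_linear_compose[OF bounded_linear_scaleC]
      simp: scaleC_scaleC mult.commute)
instance
  by standard
    (transfer; simp add: scaleC_add_right scaleC_add_left scaleC_scaleC scaleC_one)+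
end

definition jordan_prod :: "'a::ring \<Rightarrow> 'a \<Rightarrow> 'a"  (infixl "\<circ>\<^sub>J" 70) where
  "A \<circ>\<^sub>J B = A * B + B * A"

end

theory Submission
  imports Defs
begin

text \<open>Let \<open>N\<^sup>2 = 0\<close> and let \<open>P\<close> be the orthogonal projection onto \<open>ker N\<close>. Since \<open>P N = N\<close> and
  \<open>N P = 0\<close>, the operator \<open>T = c (2 P - 1)\<close> anticommutes with \<open>N\<close>, and \<open>T\<^sup>2 = c\<^sup>2\<close>. For large \<open>c\<close> the
  operator \<open>c\<^sup>2 - D1 / 2\<close> has a square root \<open>U\<close>. Put \<open>A = T + U\<close> and \<open>B = T - U\<close>, so that the
  Jordan product of \<open>A\<close> and \<open>B\<close> is \<open>2 T\<^sup>2 - 2 U\<^sup>2 = D1\<close>. As \<open>A + B = 2 T\<close> anticommutes with \<open>N\<close>,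
  the pairs \<open>(A + N, B + N)\<close> and \<open>(A - N, B - N)\<close> have Jordan product \<open>D1\<close> as well. Adding the
  two identities for the images and subtracting twice that of \<open>(A, B)\<close> leaves \<open>4 \<Psi>(N)\<^sup>2 = 0\<close>.\<close>

subsection \<open>Orthogonal projections\<close>

lemma cinner_add_right:
  "cinner x (y + z) = cinner x y + cinner x (z::'a::chilbert_space)"
  by (metis cinner_add_left cinner_commute complex_cnj_add)

lemma cinner_scaleC_right:
  "cinner x (c *\<^sub>C y) = cnj c * cinner x (y::'a::chilbert_space)"
  by (metis cinner_commute cinner_scaleC_left complex_cnj_mult)

lemma cinner_minus_left: "cinner (- x) y = - cinner x (y::'a::chilbert_space)"
  by (metis cinner_add_left add.right_inverse add_cancel_right_right eq_neg_iff_add_eq_0 add.commute)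

lemma cinner_diff_left: "cinner (x - y) z = cinner x z - cinner y (z::'a::chilbert_space)"
  by (metis cinner_add_left cinner_minus_left diff_conv_add_uminus)

lemma cinner_diff_right: "cinner z (x - y) = cinner z x - cinner z (y::'a::chilbert_space)"
  by (metis cinner_diff_left cinner_commute complex_cnj_diff)

lemma norm_sq_eq_cinner: "(norm x)\<^sup>2 = Re (cinner x (x::'a::chilbert_space))"
  by (simp add: norm_eq_sqrt_cinner cinner_ge_zero)

lemma parallelogram_law:
  fixes x y :: "'a::chilbert_space"
  shows "(norm (x + y))\<^sup>2 + (norm (x - y))\<^sup>2 = 2 * (norm x)\<^sup>2 + 2 * (norm y)\<^sup>2"
  by (simp add: norm_sq_eq_cinner cinner_add_left cinner_add_right cinner_diff_left cinner_diff_right)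

lemma norm_sq_add_orthogonal:
  fixes x y :: "'a::chilbert_space"
  assumes "cinner x y = 0"
  shows "(norm (x + y))\<^sup>2 = (norm x)\<^sup>2 + (norm y)\<^sup>2"
  using assms cinner_commute[of y x]
  by (simp add: norm_sq_eq_cinner cinner_add_left cinner_add_right)

text \<open>A minimizing sequence is Cauchy by the parallelogram law, because midpoints of its terms
  stay in \<open>K\<close>; completeness and closedness then put its limit in
  \<open>K\<close>.\<close>

lemma nearest_point_exists:
  fixes K :: "'a::chilbert_space set"
  assumes sub: "complex_vector.subspace K" and "closed K"
  obtains p where "p \<in> K" and "\<And>k. k \<in> K \<Longrightarrow> (norm (x - p))\<^sup>2 \<le> (norm (x - k))\<^sup>2"
proof -
  define d where "d = (INF k\<in>K. (norm (x - k))\<^sup>2)"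
  have "0 \<in> K" using sub by (rule complex_vector.subspace_0)
  have bdd: "bdd_below ((\<lambda>k. (norm (x - k))\<^sup>2) ` K)"
    by (rule bdd_belowI[of _ 0]) auto
  have d_le: "d \<le> (norm (x - k))\<^sup>2" if "k \<in> K" for k
    unfolding d_def using bdd that by (rule cINF_lower)
  have "\<exists>k\<in>K. (norm (x - k))\<^sup>2 < d + 1 / real (Suc n)" for n
  proof (rule ccontr)
    assume "\<not> ?thesis"
    then have "d + 1 / real (Suc n) \<le> d"
      unfolding d_def using \<open>0 \<in> K\<close> by (intro cINF_greatest) (auto simp: not_less)
    then show False by simp
  qed
  then obtain k where kK: "k n \<in> K" and k_less: "(norm (x - k n))\<^sup>2 < d + 1 / real (Suc n)" for n
    by metis
  \<comment> \<open>By the parallelogram law for \<open>x - k m\<close> and \<open>x - k n\<close>,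
    the left side is twice the two squared distances minus the squared norm of the sum, which is at
    least \<open>4 * d\<close>. Only the errors over \<open>d\<close> survive.\<close>
  have dist_k: "(dist (k m) (k n))\<^sup>2 \<le> 2 / real (Suc m) + 2 / real (Suc n)" for m n
  proof -
    have "(1/2) *\<^sub>C (k m + k n) \<in> K"
      using sub kK by (intro complex_vector.subspace_scale complex_vector.subspace_add)
    moreover have "(1/2) *\<^sub>C (k m + k n) = (1/2) *\<^sub>R (k m + k n)"
      by (simp add: scaleR_scaleC)
    ultimately have "d \<le> (norm (x - (1/2) *\<^sub>R (k m + k n)))\<^sup>2"
      using d_le by metis
    moreover have "(x - k m) + (x - k n) = 2 *\<^sub>R (x - (1/2) *\<^sub>R (k m + k n))"
      by (simp add: algebra_simps scaleR_2)
    ultimately have "4 * d \<le> (norm ((x - k m) + (x - k n)))\<^sup>2"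
      by (simp add: power_mult_distrib)
    moreover have "(dist (k m) (k n))\<^sup>2 = (norm ((x - k m) - (x - k n)))\<^sup>2"
      by (simp add: dist_norm norm_minus_commute)
    ultimately show ?thesis
      using parallelogram_law[of "x - k m" "x - k n"] k_less[of m] k_less[of n] by linarith
  qed
  have "Cauchy k"
  proof (rule metric_CauchyI)
    fix e :: real assume "0 < e"
    then obtain M where M: "inverse (real (Suc M)) < e\<^sup>2 / 4"
      using reals_Archimedean[of "e\<^sup>2 / 4"] by auto
    have "dist (k m) (k n) < e" if "m \<ge> M" "n \<ge> M" for m n
    proof -
      have "1 / real (Suc m) \<le> inverse (real (Suc M))" "1 / real (Suc n) \<le> inverse (real (Suc M))"
        using that by (auto simp: field_simps)
      then have "(dist (k m) (k n))\<^sup>2 < e\<^sup>2"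
        using dist_k[of m n] M by simp
      then show ?thesis
        using \<open>0 < e\<close> by (simp add: power2_less_imp_less)
    qed
    then show "\<exists>M. \<forall>m\<ge>M. \<forall>n\<ge>M. dist (k m) (k n) < e" by blast
  qed
  then obtain p where p: "k \<longlonglongrightarrow> p"
    using Cauchy_convergent_iff convergent_def by blast
  have "p \<in> K"
    using \<open>closed K\<close> kK p by (rule closed_sequentially)
  have "(\<lambda>n. (norm (x - k n))\<^sup>2) \<longlonglongrightarrow> (norm (x - p))\<^sup>2"
    by (intro tendsto_intros p)
  moreover have "(\<lambda>n. d + 1 / real (Suc n)) \<longlonglongrightarrow> d + 0"
    by (intro tendsto_intros LIMSEQ_Suc lim_1_over_n)
  ultimately have "(norm (x - p))\<^sup>2 \<le> d + 0"
    by (rule LIMSEQ_le) (use k_less less_imp_le in blast)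
  then have "(norm (x - p))\<^sup>2 \<le> (norm (x - k))\<^sup>2" if "k \<in> K" for k
    using d_le[OF that] by linarith
  with \<open>p \<in> K\<close> show ?thesis using that by blast
qed

text \<open>The nearest point works: a nonzero component of \<open>x - p\<close> along some
  \<open>k\<close> could be added to \<open>p\<close>, giving a point of \<open>K\<close> closer to
  \<open>x\<close>.\<close>

lemma orthogonal_decomposition_exists:
  fixes K :: "'a::chilbert_space set"
  assumes sub: "complex_vector.subspace K" and "closed K"
  obtains p where "p \<in> K" and "\<And>k. k \<in> K \<Longrightarrow> cinner (x - p) k = 0"
proof -
  obtain p where "p \<in> K" and p: "\<And>k. k \<in> K \<Longrightarrow> (norm (x - p))\<^sup>2 \<le> (norm (x - k))\<^sup>2"
    using nearest_point_exists[OF assms] by blast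
  have "cinner (x - p) k = 0" if "k \<in> K" for k
  proof (cases "k = 0")
    case True
    then show ?thesis
      by (metis add_cancel_right_right cinner_add_right)
  next
    case False
    define y where "y = x - p"
    \<comment> \<open>With this coefficient \<open>c *\<^sub>C k\<close> is the projection of
      \<open>y\<close> onto the line through \<open>k\<close>, so Pythagoras applies to the
      remainder.\<close>
    define c where "c = cinner y k / cinner k k"
    have "cinner k k \<noteq> 0" using False by (simp add: cinner_eq_zero_iff)
    have "cinner (y - c *\<^sub>C k) (c *\<^sub>C k) = 0"
      using \<open>cinner k k \<noteq> 0\<close>
      by (simp add: cinner_scaleC_right cinner_diff_left cinner_scaleC_left c_def)
    then have "(norm y)\<^sup>2 = (norm (y - c *\<^sub>C k))\<^sup>2 + (norm (c *\<^sub>C k))\<^sup>2"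
      using norm_sq_add_orthogonal by fastforce
    moreover have "p + c *\<^sub>C k \<in> K"
      using sub \<open>p \<in> K\<close> that by (intro complex_vector.subspace_scale complex_vector.subspace_add)
    then have "(norm y)\<^sup>2 \<le> (norm (y - c *\<^sub>C k))\<^sup>2"
      using p by (metis y_def diff_diff_add)
    ultimately have "(norm (c *\<^sub>C k))\<^sup>2 \<le> 0" by linarith
    then have "c *\<^sub>C k = 0" by simp
    then have "c = 0" using False by simp
    then show ?thesis
      using \<open>cinner k k \<noteq> 0\<close> by (simp add: c_def y_def)
  qed
  then show ?thesis using that \<open>p \<in> K\<close> by blast
qed

text \<open>The difference \<open>p - q\<close> lies in \<open>K\<close> and is orthogonal to
  \<open>K\<close>, hence to itself. Linearity of the projection rests on this.\<close>

lemma orthogonal_decomposition_unique: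
  fixes K :: "'a::chilbert_space set"
  assumes sub: "complex_vector.subspace K"
    and "p \<in> K" "\<And>k. k \<in> K \<Longrightarrow> cinner (x - p) k = 0"
    and "q \<in> K" "\<And>k. k \<in> K \<Longrightarrow> cinner (x - q) k = 0"
  shows "p = q"
proof -
  have "p - q \<in> K"
    using sub assms(2,4) by (rule complex_vector.subspace_diff)
  then have "cinner ((x - q) - (x - p)) (p - q) = 0"
    using assms(3,5) by (simp add: cinner_diff_left)
  then show ?thesis by (simp add: cinner_eq_zero_iff)
qed

text \<open>The decomposition is chosen pointwise; uniqueness makes the choice complex-linear and
  the identity on \<open>K\<close>, and Pythagoras makes it a contraction.\<close>

lemma orthogonal_projection_exists:
  fixes K :: "'a::chilbert_space set"
  assumes sub: "complex_vector.subspace K" and "closed K"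
  obtains P :: "'a bounded_op"
  where "\<And>x. apply_op P x \<in> K" and "\<And>x. x \<in> K \<Longrightarrow> apply_op P x = x"
proof -
  have "\<forall>x. \<exists>p. p \<in> K \<and> (\<forall>k\<in>K. cinner (x - p) k = 0)"
  proof
    fix x
    show "\<exists>p. p \<in> K \<and> (\<forall>k\<in>K. cinner (x - p) k = 0)"
      by (rule orthogonal_decomposition_exists[OF assms, of x]) blast
  qed
  from choice[OF this] obtain P
    where "\<forall>x. P x \<in> K \<and> (\<forall>k\<in>K. cinner (x - P x) k = 0)" ..
  then have PK: "P x \<in> K" and orth: "k \<in> K \<Longrightarrow> cinner (x - P x) k = 0" for x k
    by blast+
  note uniq = orthogonal_decomposition_unique[OF sub]
  have add: "P (x + y) = P x + P y" for x y
  proof (rule uniq[where x = "x + y"])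
    show "P x + P y \<in> K" using sub PK by (intro complex_vector.subspace_add)
    show "cinner (x + y - (P x + P y)) k = 0" if "k \<in> K" for k
      using orth[OF that, of x] orth[OF that, of y]
      by (simp add: cinner_diff_left cinner_add_left)
  qed (use PK orth in auto)
  have scale: "P (c *\<^sub>C x) = c *\<^sub>C P x" for c x
  proof (rule uniq[where x = "c *\<^sub>C x"])
    show "c *\<^sub>C P x \<in> K" using sub PK by (intro complex_vector.subspace_scale)
    show "cinner (c *\<^sub>C x - c *\<^sub>C P x) k = 0" if "k \<in> K" for k
      using orth[OF that, of x]
      by (simp add: cinner_diff_left cinner_scaleC_left)
  qed (use PK orth in auto)
  have bound: "norm (P x) \<le> norm x * 1" for x
  proof -
    have "(norm (x - P x + P x))\<^sup>2 = (norm (x - P x))\<^sup>2 + (norm (P x))\<^sup>2"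
      by (rule norm_sq_add_orthogonal[OF orth[OF PK]])
    also have "x - P x + P x = x" by simp
    finally have "(norm (P x))\<^sup>2 \<le> (norm x)\<^sup>2"
      using zero_le_power2[of "norm (x - P x)"] by linarith
    then have "norm (P x) \<le> norm x"
      by (rule power2_le_imp_le) (rule norm_ge_zero)
    then show ?thesis by simp
  qed
  have "bounded_linear P"
    by (rule bounded_linear_intro[OF add _ bound]) (simp only: scaleR_scaleC scale)
  then have apply_P: "apply_op (Bounded_op P) = P"
    using scale by (simp add: Bounded_op_inverse)
  have "P x = x" if "x \<in> K" for x
  proof (rule uniq[where x = x])
    show "cinner (x - x) k = 0" for k by (subst cinner_diff_left) simp
  qed (use that PK orth in auto)
  with PK show ?thesis
    by (intro that[of "Bounded_op P"]) (simp_all only: apply_P)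
qed

section \<open>The reflection attached to a square-zero operator\<close>

lemma bounded_linear_apply_op: "bounded_linear (apply_op A)"
  using apply_op[of A] by simp

lemma apply_op_scaleC: "apply_op A (c *\<^sub>C x) = c *\<^sub>C apply_op A x"
  using apply_op[of A] by simp

text \<open>The witness is the reflection in the kernel of \<open>N\<close>. It fixes the kernel,
  which contains the range of \<open>N\<close>, so \<open>J * N = N\<close>; and
  \<open>N * P = 0\<close> gives \<open>N * J = - N\<close>.\<close>

lemma anticommuting_involution_exists:
  fixes N :: "'a::chilbert_space bounded_op"
  assumes "N * N = 0"
  obtains J where "J * J = 1" and "N \<circ>\<^sub>J J = 0"
proof -
  define K where "K = {x. apply_op N x = 0}"
  interpret N: bounded_linear "apply_op N" by (rule bounded_linear_apply_op)
  have "complex_vector.subspace K"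
    by (rule complex_vector.subspaceI) (auto simp: K_def N.zero N.add apply_op_scaleC)
  moreover have "closed K"
    unfolding K_def by (intro closed_Collect_eq N.continuous_on continuous_intros)
  ultimately obtain P where P: "apply_op P x \<in> K" "x \<in> K \<Longrightarrow> apply_op P x = x" for x
    using orthogonal_projection_exists by metis
  have NN: "apply_op N (apply_op N x) = 0" for x
    by (metis assms times_bounded_op.rep_eq zero_bounded_op.rep_eq)
  have eqI: "A = B" if "\<And>x. apply_op A x = apply_op B x" for A B :: "'a bounded_op"
    using that by (intro iffD1[OF apply_op_inject] ext)
  have "P * P = P"
    by (rule eqI) (simp add: times_bounded_op.rep_eq P)
  moreover have "P * N = N"
    by (rule eqI) (simp add: times_bounded_op.rep_eq P K_def NN)
  moreover have "N * P = 0"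
    using P(1) by (intro eqI) (simp add: times_bounded_op.rep_eq zero_bounded_op.rep_eq K_def)
  ultimately have "(P + P - 1) * (P + P - 1) = 1" "N \<circ>\<^sub>J (P + P - 1) = 0"
    by (simp_all add: jordan_prod_def algebra_simps)
  then show ?thesis using that by blast
qed

subsection \<open>Square roots near the identity\<close>

text \<open>\<open>1 - Y\<close> is a square root of \<open>1 - X\<close> iff \<open>Y\<close> is a fixed point of \<open>Y \<mapsto> (X + Y\<^sup>2) / 2\<close>, which
  is a contraction on the ball of radius \<open>1/2\<close>.\<close>

lemma sqrt_one_minus_exists:
  fixes X :: "'a::chilbert_space bounded_op"
  assumes X: "\<And>x. norm (apply_op X x) \<le> norm x / 2"
  obtains U where "U * U = 1 - X"
proof -
  define X' where "X' = Blinfun (apply_op X)"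
  have X'_apply: "blinfun_apply X' = apply_op X"
    unfolding X'_def by (rule bounded_linear_Blinfun_apply[OF bounded_linear_apply_op])
  have X'_norm: "norm X' \<le> 1/2"
    by (rule norm_blinfun_bound) (use X in \<open>auto simp: X'_apply\<close>)
  \<comment> \<open>The fixed point is sought among real-linear bounded maps, a Banach space under
    the operator norm. Complex homogeneity is a closed condition preserved by \<open>f\<close>, so
    it can be built into the complete set \<open>S\<close>.\<close>
  define S where "S = cball (0 :: 'a \<Rightarrow>\<^sub>L 'a) (1/2) \<inter> {Y. \<forall>c x. blinfun_apply Y (c *\<^sub>C x) = c *\<^sub>C blinfun_apply Y x}"
  define f where "f Y = (1/2) *\<^sub>R (X' + (Y o\<^sub>L Y))" for Y
  have cont: "continuous_on UNIV (\<lambda>Y::'a \<Rightarrow>\<^sub>L 'a. c *\<^sub>C blinfun_apply Y x)" for c x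
    by (rule continuous_on_compose2[of UNIV "\<lambda>y. c *\<^sub>C y"])
      (auto intro!: continuous_intros linear_continuous_on bounded_linear_scaleC)
  have "closed {Y :: 'a \<Rightarrow>\<^sub>L 'a. \<forall>c x. blinfun_apply Y (c *\<^sub>C x) = c *\<^sub>C blinfun_apply Y x}"
    by (intro closed_Collect_all closed_Collect_eq cont continuous_intros)
  then have "complete S"
    unfolding S_def by (simp add: complete_eq_closed closed_Int)
  moreover have "0 \<in> S"
    by (simp add: S_def)
  moreover have "f ` S \<subseteq> S"
  proof
    fix Z assume "Z \<in> f ` S"
    then obtain Y where Y: "norm Y \<le> 1/2" "\<And>c x. blinfun_apply Y (c *\<^sub>C x) = c *\<^sub>C blinfun_apply Y x" and Z: "Z = f Y"
      by (auto simp: S_def)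
    have "norm (Y o\<^sub>L Y) \<le> 1/2 * (1/2)"
      using norm_blinfun_compose[of Y Y] mult_mono[OF Y(1) Y(1)] by simp
    then have "norm (X' + (Y o\<^sub>L Y)) \<le> 1"
      using norm_triangle_ineq[of X' "Y o\<^sub>L Y"] X'_norm by simp
    then have "norm Z \<le> 1/2"
      by (simp add: Z f_def)
    moreover have "blinfun_apply Z (c *\<^sub>C x) = c *\<^sub>C blinfun_apply Z x" for c x
      by (simp add: Z f_def X'_apply apply_op_scaleC blinfun.bilinear_simps Y(2)
          scaleR_scaleC scaleC_scaleC scaleC_add_right mult.commute)
    ultimately show "Z \<in> S" by (simp add: S_def)
  qed
  moreover have "dist (f Y) (f Z) \<le> 1/2 * dist Y Z" if "Y \<in> S" "Z \<in> S" for Y Z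
  proof -
    have YZ: "norm Y \<le> 1/2" "norm Z \<le> 1/2" using that by (auto simp: S_def)
    \<comment> \<open>A difference of squares that respects the order of the factors. Each summand
      has norm at most half that of \<open>Y - Z\<close>, and the outer factor halves their
      sum.\<close>
    have "f Y - f Z = (1/2) *\<^sub>R ((Y o\<^sub>L (Y - Z)) + ((Y - Z) o\<^sub>L Z))"
      by (rule blinfun_eqI) (simp add: f_def blinfun.bilinear_simps scaleR_add_right scaleR_diff_right)
    moreover have "norm (Y o\<^sub>L (Y - Z)) \<le> 1/2 * norm (Y - Z)"
      using norm_blinfun_compose[of Y "Y - Z"] mult_right_mono[OF YZ(1), of "norm (Y - Z)"] by simp
    moreover have "norm ((Y - Z) o\<^sub>L Z) \<le> 1/2 * norm (Y - Z)"
      using norm_blinfun_compose[of "Y - Z" Z] mult_left_mono[OF YZ(2), of "norm (Y - Z)"] by simp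
    ultimately show ?thesis
      using norm_triangle_ineq[of "Y o\<^sub>L (Y - Z)" "(Y - Z) o\<^sub>L Z"] by (simp add: dist_norm)
  qed
  ultimately obtain Y where "Y \<in> S" and fix_Y: "f Y = Y"
    using Banach_fix[of S "1/2" f] by auto
  define V where "V = Bounded_op (blinfun_apply Y)"
  have V: "apply_op V = blinfun_apply Y"
    unfolding V_def using \<open>Y \<in> S\<close>
    by (intro Bounded_op_inverse) (simp add: S_def blinfun.bounded_linear_right)
  have "apply_op (V + V) x = apply_op (X + V * V) x" for x
  proof -
    have "2 *\<^sub>R Y x = 2 *\<^sub>R f Y x" by (simp add: fix_Y)
    also have "\<dots> = X' x + Y (Y x)"
      by (simp add: f_def blinfun.bilinear_simps)
    finally show ?thesis
      by (simp add: plus_bounded_op.rep_eq times_bounded_op.rep_eq V X'_apply scaleR_2)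
  qed
  then have "V + V = X + V * V"
    by (intro iffD1[OF apply_op_inject] ext)
  moreover have "(1 - V) * (1 - V) = 1 + V * V - (V + V)"
    by (simp add: algebra_simps)
  ultimately have "(1 - V) * (1 - V) = 1 - X"
    by simp
  then show ?thesis by (rule that)
qed

section \<open>Writing an operator as a Jordan product\<close>

lemma scaleC_times_left: "(c *\<^sub>C A) * B = c *\<^sub>C (A * B)"
  for A B :: "'a::chilbert_space bounded_op"
  by transfer simp

lemma scaleC_times_right: "A * (c *\<^sub>C B) = c *\<^sub>C (A * B)"
  for A B :: "'a::chilbert_space bounded_op"
  by transfer simp

text \<open>Scaling \<open>D\<close> by \<open>1 / (2 * b)\<close> brings its norm down to at most
  1/2, where a root of \<open>1 - X\<close> exists; multiplying that root by a square root
  \<open>c\<close> of \<open>2 * b\<close> undoes the scaling.\<close>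

lemma shifted_sqrt_exists:
  fixes D :: "'a::chilbert_space bounded_op"
  obtains c U where "U * U = (c * c) *\<^sub>C 1 - D"
proof -
  obtain b where "0 < b" and b: "\<And>x. norm (apply_op D x) \<le> norm x * b"
    using bounded_linear.pos_bounded[OF bounded_linear_apply_op] by metis
  define r where "r = inverse (2 * b)"
  have "norm (apply_op (complex_of_real r *\<^sub>C D) x) \<le> norm x / 2" for x
  proof -
    have "apply_op (complex_of_real r *\<^sub>C D) x = r *\<^sub>R apply_op D x"
      by (simp add: scaleC_bounded_op.rep_eq scaleR_scaleC)
    then have "norm (apply_op (complex_of_real r *\<^sub>C D) x) \<le> r * (norm x * b)"
      using b[of x] \<open>0 < b\<close> by (simp add: r_def)
    also have "\<dots> = norm x / 2"
      using \<open>0 < b\<close> by (simp add: r_def)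
    finally show ?thesis .
  qed
  then obtain U where U: "U * U = 1 - complex_of_real r *\<^sub>C D"
    using sqrt_one_minus_exists by blast
  define c where "c = csqrt (complex_of_real (2 * b))"
  have "c * c = complex_of_real (2 * b)"
    by (metis c_def power2_csqrt power2_eq_square)
  then have "c * c * complex_of_real r = 1"
    using \<open>0 < b\<close> by (simp add: r_def)
  moreover have "(c *\<^sub>C U) * (c *\<^sub>C U) = (c * c) *\<^sub>C (1 - complex_of_real r *\<^sub>C D)"
    by (simp add: scaleC_times_left scaleC_times_right scaleC_scaleC U)
  ultimately have "(c *\<^sub>C U) * (c *\<^sub>C U) = (c * c) *\<^sub>C 1 - D"
    by (simp add: complex_vector.scale_right_diff_distrib scaleC_scaleC scaleC_one)
  then show ?thesis by (rule that)
qed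

lemma jordan_factorization_exists:
  fixes D N :: "'a::chilbert_space bounded_op"
  assumes "N * N = 0"
  obtains A B where "A \<circ>\<^sub>J B = D" and "N \<circ>\<^sub>J (A + B) = 0"
proof -
  obtain J where J: "J * J = 1" "N \<circ>\<^sub>J J = 0"
    using anticommuting_involution_exists[OF assms] .
  \<comment> \<open>Half of \<open>D\<close> is used because the Jordan product below doubles
    \<open>T * T - U * U\<close>.\<close>
  obtain c U where U: "U * U = (c * c) *\<^sub>C 1 - (1/2) *\<^sub>C D"
    using shifted_sqrt_exists .
  define T where "T = c *\<^sub>C J"
  have "T * T = (c * c) *\<^sub>C 1"
    by (simp add: T_def scaleC_times_left scaleC_times_right scaleC_scaleC J)
  then have "T * T - U * U = (1/2) *\<^sub>C D"
    by (simp add: U)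
  \<comment> \<open>The mixed terms \<open>U * T - T * U\<close> and \<open>T * U - U * T\<close> of
    the two orders cancel.\<close>
  moreover have "(T + U) \<circ>\<^sub>J (T - U) = (T * T - U * U) + (T * T - U * U)"
    by (simp add: jordan_prod_def algebra_simps)
  ultimately have "(T + U) \<circ>\<^sub>J (T - U) = D"
    by (simp add: scaleC_one flip: scaleC_add_left)
  moreover have "N * T + T * N = 0"
    using J(2) unfolding T_def jordan_prod_def
    by (simp add: scaleC_times_left scaleC_times_right flip: scaleC_add_right)
  then have "N \<circ>\<^sub>J ((T + U) + (T - U)) = 0"
    by (simp add: jordan_prod_def algebra_simps)
  ultimately show ?thesis by (rule that)
qed

subsection \<open>Square-zero preservation\<close>

theorem theorem1p3:
  fixes D1 :: "'a::chilbert_space bounded_op"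
    and D2 :: "'b::chilbert_space bounded_op"
    and \<Psi> :: "'a bounded_op \<Rightarrow> 'b bounded_op"
  assumes "infinite_cdim TYPE('a)"
    and "infinite_cdim TYPE('b)"
    and "clinear \<Psi>"
    and "\<And>A1 A2. A1 \<circ>\<^sub>J A2 = D1 \<Longrightarrow> \<Psi> A1 \<circ>\<^sub>J \<Psi> A2 = D2"
  shows "\<forall>A1. A1\<^sup>2 = 0 \<longrightarrow> (\<Psi> A1)\<^sup>2 = 0"
proof (intro allI impI)
  fix N :: "'a bounded_op"
  assume "N\<^sup>2 = 0"
  then have N: "N * N = 0" by (simp add: power2_eq_square)
  interpret \<Psi>: Vector_Spaces.linear scaleC scaleC \<Psi> by fact
  obtain A B where AB: "A \<circ>\<^sub>J B = D1" "N \<circ>\<^sub>J (A + B) = 0"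
    using jordan_factorization_exists[OF N] .
  \<comment> \<open>Perturbing both factors by the same multiple of \<open>N\<close> changes the
    product by a linear term, killed by the choice of \<open>A + B\<close>, and a quadratic term,
    killed by \<open>N * N = 0\<close>.\<close>
  have "(A + N) \<circ>\<^sub>J (B + N) = A \<circ>\<^sub>J B + N \<circ>\<^sub>J (A + B) + (N * N + N * N)"
    and "(A - N) \<circ>\<^sub>J (B - N) = A \<circ>\<^sub>J B - N \<circ>\<^sub>J (A + B) + (N * N + N * N)"
    by (simp_all add: jordan_prod_def algebra_simps)
  then have "(A + N) \<circ>\<^sub>J (B + N) = D1" "(A - N) \<circ>\<^sub>J (B - N) = D1"
    by (simp_all add: AB N)
  then have "\<Psi> A \<circ>\<^sub>J \<Psi> B = D2" "(\<Psi> A + \<Psi> N) \<circ>\<^sub>J (\<Psi> B + \<Psi> N) = D2"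
    "(\<Psi> A - \<Psi> N) \<circ>\<^sub>J (\<Psi> B - \<Psi> N) = D2"
    using assms(4) AB(1) by (metis \<Psi>.add \<Psi>.diff)+
  \<comment> \<open>Terms linear in \<open>\<Psi> N\<close> have opposite signs in the two products,
    so only the quadratic ones remain beside twice the unperturbed product.\<close>
  moreover have "(\<Psi> A + \<Psi> N) \<circ>\<^sub>J (\<Psi> B + \<Psi> N) + (\<Psi> A - \<Psi> N) \<circ>\<^sub>J (\<Psi> B - \<Psi> N)
      = \<Psi> A \<circ>\<^sub>J \<Psi> B + \<Psi> A \<circ>\<^sub>J \<Psi> B
        + (\<Psi> N * \<Psi> N + \<Psi> N * \<Psi> N + (\<Psi> N * \<Psi> N + \<Psi> N * \<Psi> N))"
    by (simp add: jordan_prod_def algebra_simps)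
  ultimately have "\<Psi> N * \<Psi> N + \<Psi> N * \<Psi> N + (\<Psi> N * \<Psi> N + \<Psi> N * \<Psi> N) = 0"
    by simp
  \<comment> \<open>As a scalar multiple, the fourfold sum can be cancelled by the vector space
    law.\<close>
  moreover have "X + X + (X + X) = 4 *\<^sub>C X" for X :: "'b bounded_op"
    using scaleC_add_left[of 1 1 X] scaleC_add_left[of 2 2 X] by (simp add: scaleC_one)
  ultimately show "(\<Psi> N)\<^sup>2 = 0"
    by (simp add: power2_eq_square)
qed

end
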